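(* Let $(X, p)$ be a compact pseudometric space, and let $T : X \to X$ be a homeomorphism. Let $\mu$ be a regular Borel probability measure on $X$. Suppose there exist functions $H, L : \mathbb{Z} \to (0, \infty)$ such that $$p\left( T^j x, T^j y \right) \leq L(j) \cdot p(x, y)^{H(j)} \qquad (\forall j \in \mathbb{Z},\ x \in X,\ y \in X).$$ Let $x_0 \in X$. Let $(F_k)_{k=1}^\infty$ be a sequence of finite nonempty subsets of $\mathbb{Z}$. Let $\Xi$ be a uniformly equicontinuous family of continuous functions $X \to \mathbb{T}$, and for each $j \in \mathbb{Z}$, let $\Delta^j$ be a modulus of uniform equicontinuity for $\Xi^j = \{ \xi^j : \xi \in \Xi\}$. Let $(C_k)_{k=1}^\infty$ be a sequence of measurable subsets of $X$ such that $\mu(C_k) > 0$ and $x_0 \in C_k$ for all $k \in \mathbb{N}$. Suppose that for every $\delta > 0$ and $\epsilon \in (0,1)$, $$\lim_{k \to \infty} \frac{\left| \left\{ j \in F_k : L(j) \cdot \operatorname{diam}(C_k)^{H(j)} > \delta \right\} \right|}{|F_k|} = 0 , \qquad \lim_{k \to \infty} \frac{\left| \left\{ j \in F_k : \operatorname{diam}(C_k) > \Delta^j(\epsilon) \right\} \right|}{|F_k|} = 0 .$$ Let $f : X \to \mathbb{C}$ be a uniformly bounded continuous function. Finally, suppose there exists a constant $\lambda > 0$ such that $\mu\left( T^j C_k \right) \leq \lambda \mu(C_k)$ for all $j \in \mathbb{N}$ and all $k \in \mathbb{N}$. Then for all $\xi \in \Xi$, $$\lim_{k \to \infty} \left| \left(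 \operatorname{Avg}_{F_k}^\xi f \right)(x_0) - \alpha_{C_k}\left( \operatorname{Avg}_{F_k}^\xi f \right) \right| = 0 ,$$ and the convergence is uniform in $\xi \in \Xi$.
   Context: $\mathbb{T} = \{ z \in \mathbb{C} : |z| = 1\}$. For $\xi : X \to \mathbb{T}$ and a finite nonempty $F \subseteq \mathbb{Z}$, $\operatorname{Avg}_F^\xi f = \frac{1}{|F|} \sum_{j \in F} \xi^j \cdot (f \circ T^j)$, where $\xi^j$ is the pointwise $j$-th power. A modulus of uniform equicontinuity for a family $\Xi$ of functions $X \to \mathbb{C}$ is a function $\Delta : (0,1) \to (0,\infty)$ such that for all $\xi \in \Xi$, $\epsilon \in (0,1)$ and $x_1, x_2 \in X$, $p(x_1,x_2) \leq \Delta(\epsilon)$ implies $|\xi(x_1) - \xi(x_2)| \leq \epsilon$. For a measurable $C \subseteq X$ with $\mu(C)>0$, $\alpha_C(h) = \frac{1}{\mu(C)} \int_C h \, \mathrm{d}\mu$. $\operatorname{diam}(C) = \sup_{x,y \in C} p(x,y)$. *)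

theory Defs
  imports "HOL-Probability.Probability"
begin

definition pseudometric_on :: "'a set \<Rightarrow> ('a \<Rightarrow> 'a \<Rightarrow> real) \<Rightarrow> bool" where
  "pseudometric_on X p \<longleftrightarrow>
     (\<forall>x\<in>X. \<forall>y\<in>X. 0 \<le> p x y) \<and>
     (\<forall>x\<in>X. p x x = 0) \<and>
     (\<forall>x\<in>X. \<forall>y\<in>X. p x y = p y x) \<and>
     (\<forall>x\<in>X. \<forall>y\<in>X. \<forall>z\<in>X. p x z \<le> p x y + p y z)"

definition pm_topology :: "'a set \<Rightarrow> ('a \<Rightarrow> 'a \<Rightarrow> real) \<Rightarrow> 'a topology" where
  "pm_topology X p =
     topology (\<lambda>U. U \<subseteq> X \<and> (\<forall>x\<in>U. \<exists>r>0. {y \<in> X. p x y < r} \<subseteq> U))"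

lemma openin_pm_topology:
  "openin (pm_topology X p) U \<longleftrightarrow>
     U \<subseteq> X \<and> (\<forall>x\<in>U. \<exists>r>0. {y \<in> X. p x y < r} \<subseteq> U)"
proof -
  have "istopology (\<lambda>U. U \<subseteq> X \<and> (\<forall>x\<in>U. \<exists>r>0. {y \<in> X. p x y < r} \<subseteq> U))"
    unfolding istopology_def
  proof (rule conjI; intro allI impI)
    fix S T
    assume S: "S \<subseteq> X \<and> (\<forall>x\<in>S. \<exists>r>0. {y \<in> X. p x y < r} \<subseteq> S)"
      and T: "T \<subseteq> X \<and> (\<forall>x\<in>T. \<exists>r>0. {y \<in> X. p x y < r} \<subseteq> T)"
    show "S \<inter> T \<subseteq> X \<and> (\<forall>x\<in>S \<inter> T. \<exists>r>0. {y \<in> X. p x y < r} \<subseteq> S \<inter> T)"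
    proof (intro conjI ballI)
      show "S \<inter> T \<subseteq> X" using S by blast
      fix x assume x: "x \<in> S \<inter> T"
      obtain r where "r > 0" "{y \<in> X. p x y < r} \<subseteq> S" using S x by blast
      moreover obtain s where "s > 0" "{y \<in> X. p x y < s} \<subseteq> T" using T x by blast
      ultimately show "\<exists>r>0. {y \<in> X. p x y < r} \<subseteq> S \<inter> T"
        by (intro exI[of _ "min r s"]) auto
    qed
  next
    fix K
    assume "\<forall>U\<in>K. U \<subseteq> X \<and> (\<forall>x\<in>U. \<exists>r>0. {y \<in> X. p x y < r} \<subseteq> U)"
    then show "\<Union>K \<subseteq> X \<and> (\<forall>x\<in>\<Union>K. \<exists>r>0. {y \<in> X. p x y < r} \<subseteq> \<Union>K)"
      by (meson UnionE Union_least Union_upper subset_trans)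
  qed
  then show ?thesis
    by (simp add: pm_topology_def topology_inverse')
qed

lemma topspace_pm_topology [simp]: "topspace (pm_topology X p) = X"
proof
  show "topspace (pm_topology X p) \<subseteq> X"
    using openin_pm_topology[of X p "topspace (pm_topology X p)"] by simp
  have "openin (pm_topology X p) X"
    unfolding openin_pm_topology by (auto intro: exI[of _ 1])
  then show "X \<subseteq> topspace (pm_topology X p)"
    by (rule openin_subset)
qed

definition borel_of_topology :: "'a topology \<Rightarrow> 'a measure" where
  "borel_of_topology \<tau> = sigma (topspace \<tau>) {U. openin \<tau> U}"

(* A pseudometric topology need not be Hausdorff, so a compact set need not be Borel; hence the
   requirement K : sets M in the inner approximation. *)
definition regular_borel_measure :: "'a topology \<Rightarrow> 'a measure \<Rightarrow> bool" where
  "regular_borel_measure \<tau> M \<longleftrightarrow>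
     sets M = sets (borel_of_topology \<tau>) \<and>
     (\<forall>A\<in>sets M.
        emeasure M A = (INF U\<in>{U. openin \<tau> U \<and> A \<subseteq> U}. emeasure M U) \<and>
        emeasure M A = (SUP K\<in>{K. compactin \<tau> K \<and> K \<in> sets M \<and> K \<subseteq> A}. emeasure M K))"

(* T is meant to be a bijection of X; its values outside X are irrelevant at points of X. *)
definition int_iter :: "'a set \<Rightarrow> ('a \<Rightarrow> 'a) \<Rightarrow> int \<Rightarrow> 'a \<Rightarrow> 'a" where
  "int_iter X T j = (if 0 \<le> j then T ^^ nat j else inv_into X T ^^ nat (- j))"

(* The supremum of reals is the intended one because p is bounded on a compact X and this is only
   applied to nonempty sets. *)
definition pm_diam :: "('a \<Rightarrow> 'a \<Rightarrow> real) \<Rightarrow> 'a set \<Rightarrow> real" where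
  "pm_diam p C = (SUP (x, y)\<in>C \<times> C. p x y)"

definition uniformly_equicontinuous ::
    "'a set \<Rightarrow> ('a \<Rightarrow> 'a \<Rightarrow> real) \<Rightarrow> ('a \<Rightarrow> complex) set \<Rightarrow> bool" where
  "uniformly_equicontinuous X p \<Xi> \<longleftrightarrow>
     (\<forall>\<epsilon>>0. \<exists>\<delta>>0. \<forall>\<xi>\<in>\<Xi>. \<forall>x\<in>X. \<forall>y\<in>X. p x y < \<delta> \<longrightarrow> cmod (\<xi> x - \<xi> y) < \<epsilon>)"

(* D represents a function from (0,1) to the positive reals; its values elsewhere are irrelevant. *)
definition modulus_of_equicontinuity ::
    "'a set \<Rightarrow> ('a \<Rightarrow> 'a \<Rightarrow> real) \<Rightarrow> ('a \<Rightarrow> complex) set \<Rightarrow> (real \<Rightarrow> real) \<Rightarrow> bool" where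
  "modulus_of_equicontinuity X p \<Xi> D \<longleftrightarrow>
     (\<forall>\<epsilon>\<in>{0<..<1}. 0 < D \<epsilon>) \<and>
     (\<forall>\<xi>\<in>\<Xi>. \<forall>\<epsilon>\<in>{0<..<1}. \<forall>x\<in>X. \<forall>y\<in>X. p x y \<le> D \<epsilon> \<longrightarrow> cmod (\<xi> x - \<xi> y) \<le> \<epsilon>)"

definition fun_powi :: "('a \<Rightarrow> complex) \<Rightarrow> int \<Rightarrow> 'a \<Rightarrow> complex" where
  "fun_powi \<xi> j = (\<lambda>x. \<xi> x powi j)"

definition weighted_avg ::
    "'a set \<Rightarrow> ('a \<Rightarrow> 'a) \<Rightarrow> int set \<Rightarrow> ('a \<Rightarrow> complex) \<Rightarrow> ('a \<Rightarrow> complex) \<Rightarrow> 'a \<Rightarrow> complex" where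
  "weighted_avg X T F \<xi> f =
     (\<lambda>x. 1 / of_nat (card F) * (\<Sum>j\<in>F. fun_powi \<xi> j x * f (int_iter X T j x)))"

definition mean_over :: "'a measure \<Rightarrow> 'a set \<Rightarrow> ('a \<Rightarrow> complex) \<Rightarrow> complex" where
  "mean_over M C h = complex_of_real (1 / measure M C) * (LINT x:C|M. h x)"

end

theory Submission
  imports Defs
begin

text \<open>
  For $x \in C_k$ the $j$-th terms of the averages at $x_0$ and at $x$ are close unless $j$ belongs
  to one of the two exceptional sets: outside the first one, $T^j x_0$ and $T^j x$ are close and
  uniform continuity of $f$ applies; outside the second one, $\xi^j(x_0)$ and $\xi^j(x)$ are close.
  The exceptional sets have vanishing density in $F_k$ and the terms are bounded, so the averages
  at $x_0$ and $x$ differ by a quantity that is small uniformly in $\xi$ and in $x \in C_k$. Taking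
  the mean over $C_k$ preserves the bound.
\<close>

section \<open>Compactness arguments in a pseudometric space\<close>

lemma openin_pm_ball:
  assumes "pseudometric_on X p" "x \<in> X"
  shows "openin (pm_topology X p) {y \<in> X. p x y < r}"
  unfolding openin_pm_topology
proof (intro conjI ballI)
  fix y assume y: "y \<in> {y \<in> X. p x y < r}"
  have "p x z < r" if "z \<in> X" "p y z < r - p x y" for z
  proof -
    have "p x z \<le> p x y + p y z"
      using assms y that by (auto simp: pseudometric_on_def)
    then show ?thesis using that by linarith
  qed
  then have "{z \<in> X. p y z < r - p x y} \<subseteq> {y \<in> X. p x y < r}" by auto
  with y show "\<exists>s>0. {z \<in> X. p y z < s} \<subseteq> {y \<in> X. p x y < r}"
    by (intro exI[of _ "r - p x y"]) auto
qed auto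

text \<open>The radius may depend on the centre: boundedness needs only unit balls, but uniform
  continuity needs radii adapted to each point. Each ball contains its own centre because
  \<open>p x x = 0\<close>, so the balls cover \<open>X\<close>.\<close>

lemma compact_pm_ball_cover:
  assumes pm: "pseudometric_on X p" and cpt: "compact_space (pm_topology X p)"
    and r: "\<And>x. x \<in> X \<Longrightarrow> 0 < r x"
  obtains S where "finite S" "S \<subseteq> X" "X \<subseteq> (\<Union>x\<in>S. {y \<in> X. p x y < r x})"
proof -
  let ?B = "\<lambda>x. {y \<in> X. p x y < r x}"
  have "p x x = 0" if "x \<in> X" for x
    using pm that unfolding pseudometric_on_def by blast
  then have "x \<in> ?B x" if "x \<in> X" for x
    using r that by simp
  then have "X \<subseteq> \<Union>(?B ` X)" by blast
  moreover have "\<forall>U\<in>?B ` X. openin (pm_topology X p) U"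
    using openin_pm_ball[OF pm] by blast
  ultimately obtain \<F> where \<F>: "finite \<F>" "\<F> \<subseteq> ?B ` X" "X \<subseteq> \<Union>\<F>"
    using cpt[unfolded compact_space_alt, rule_format, of "?B ` X"] by auto
  obtain S where "S \<subseteq> X" "finite S" "\<F> = ?B ` S"
    using finite_subset_image[OF \<F>(1,2)] by blast
  with \<F>(3) show thesis by (intro that) auto
qed

text \<open>Any two points are linked through two centres of a finite cover by unit balls, and only
  finitely many distances between centres occur.\<close>

lemma compact_pm_bounded:
  assumes pm: "pseudometric_on X p" and cpt: "compact_space (pm_topology X p)"
  obtains K where "\<And>x y. x \<in> X \<Longrightarrow> y \<in> X \<Longrightarrow> p x y \<le> K"
proof -
  obtain S where S: "finite S" "S \<subseteq> X" "X \<subseteq> (\<Union>x\<in>S. {y \<in> X. p x y < 1})"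
    using compact_pm_ball_cover[OF pm cpt, of "\<lambda>_. 1"] by auto
  \<comment> \<open>A sum of nonnegative terms dominates each of them; unlike a maximum, it also
    makes sense when \<open>S\<close> is empty.\<close>
  define K where "K = (\<Sum>(a, b)\<in>S \<times> S. p a b)"
  have nonneg: "0 \<le> p a b" if "a \<in> X" "b \<in> X" for a b
    using pm that by (simp add: pseudometric_on_def)
  have "p x y \<le> K + 2" if xy: "x \<in> X" "y \<in> X" for x y
  proof -
    obtain a b where ab: "a \<in> S" "p a x < 1" "b \<in> S" "p b y < 1" using S xy by blast
    have "a \<in> X" "b \<in> X" using ab S by auto
    then have "p x y \<le> p x a + p a y" "p a y \<le> p a b + p b y" "p x a = p a x"
      using pm xy unfolding pseudometric_on_def by blast+
    moreover have "p a b \<le> K"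
      unfolding K_def
      using member_le_sum[of "(a, b)" "S \<times> S" "\<lambda>(a, b). p a b"] ab S nonneg
      by (auto simp: subset_iff)
    ultimately show ?thesis using ab by linarith
  qed
  then show thesis by (rule that)
qed

text \<open>A real supremum bounds its set only if that set is bounded above, which is what
  compactness provides here.\<close>

lemma pm_le_pm_diam:
  assumes "pseudometric_on X p" "compact_space (pm_topology X p)"
    and "C \<subseteq> X" "x \<in> C" "y \<in> C"
  shows "p x y \<le> pm_diam p C"
proof -
  obtain K where "\<And>x y. x \<in> X \<Longrightarrow> y \<in> X \<Longrightarrow> p x y \<le> K"
    using compact_pm_bounded assms(1,2) by blast
  then have "bdd_above ((\<lambda>(x, y). p x y) ` (C \<times> C))"
    using \<open>C \<subseteq> X\<close> by (intro bdd_aboveI[of _ K]) auto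
  from cSUP_upper[OF _ this, of "(x, y)"] assms(4,5) show ?thesis
    by (simp add: pm_diam_def)
qed

text \<open>The Heine-Cantor theorem, by a Lebesgue number argument that never uses separation of
  points.\<close>

lemma continuous_pm_uniformly_continuous:
  fixes f :: "'a \<Rightarrow> 'b::metric_space"
  assumes pm: "pseudometric_on X p" and cpt: "compact_space (pm_topology X p)"
    and f: "continuous_map (pm_topology X p) euclidean f" and "0 < e"
  obtains d where "0 < d" "\<And>x y. x \<in> X \<Longrightarrow> y \<in> X \<Longrightarrow> p x y < d \<Longrightarrow> dist (f x) (f y) < e"
proof -
  \<comment> \<open>Continuity is recorded on radius \<open>2 * r\<close> while the cover uses
    radius \<open>r\<close>, so a point within \<open>r\<close> of a covered point still lies in the
    controlled ball.\<close>
  have "\<exists>r>0. \<forall>y\<in>X. p x y < 2 * r \<longrightarrow> dist (f x) (f y) < e / 2" if x: "x \<in> X" for x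
  proof -
    have "openin (pm_topology X p) {y \<in> topspace (pm_topology X p). f y \<in> ball (f x) (e / 2)}"
      by (rule openin_continuous_map_preimage[OF f]) simp
    then obtain s where "s > 0" "{y \<in> X. p x y < s} \<subseteq> {y \<in> X. f y \<in> ball (f x) (e / 2)}"
      using x \<open>0 < e\<close> unfolding openin_pm_topology by fastforce
    then show ?thesis by (intro exI[of _ "s / 2"]) auto
  qed
  then obtain r where r: "\<And>x. x \<in> X \<Longrightarrow> 0 < r x"
    and fr: "\<And>x y. x \<in> X \<Longrightarrow> y \<in> X \<Longrightarrow> p x y < 2 * r x \<Longrightarrow> dist (f x) (f y) < e / 2"
    using bchoice[of X "\<lambda>x r. 0 < r \<and> (\<forall>y\<in>X. p x y < 2 * r \<longrightarrow> dist (f x) (f y) < e / 2)"]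
    by blast
  obtain S where S: "finite S" "S \<subseteq> X" "X \<subseteq> (\<Union>x\<in>S. {y \<in> X. p x y < r x})"
    by (rule compact_pm_ball_cover[OF pm cpt, of r]) (use r in blast)+
  \<comment> \<open>Inserting 1 keeps the set nonempty even if \<open>S\<close> is empty.\<close>
  define d where "d = Min (insert 1 (r ` S))"
  have "0 < d" using S r by (auto simp: d_def)
  moreover have "dist (f x) (f y) < e" if xy: "x \<in> X" "y \<in> X" "p x y < d" for x y
  proof -
    obtain a where a: "a \<in> S" "p a x < r a" using S xy by blast
    have "a \<in> X" using a S by auto
    have "d \<le> r a" using S a by (simp add: d_def)
    have "p a y \<le> p a x + p x y"
      using pm \<open>a \<in> X\<close> xy unfolding pseudometric_on_def by blast
    then have "dist (f a) (f y) < e / 2" using fr \<open>a \<in> X\<close> xy a \<open>d \<le> r a\<close> by simp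
    moreover have "dist (f a) (f x) < e / 2" using fr \<open>a \<in> X\<close> xy a r[of a] by simp
    ultimately show ?thesis using dist_triangle_half_r by blast
  qed
  ultimately show thesis by (rule that)
qed

section \<open>Continuity of the iterates and Borel measurability\<close>

lemma continuous_map_funpow:
  assumes "continuous_map X X T"
  shows "continuous_map X X (T ^^ n)"
proof (induction n)
  case 0
  show ?case by (simp add: id_def)
next
  case (Suc n)
  show ?case using continuous_map_compose[OF Suc assms] by (simp add: comp_def)
qed

text \<open>Negative iterates use \<open>inv_into\<close>, which by injectivity of \<open>T\<close>
  agrees on the space with the continuous inverse supplied by the homeomorphism.\<close>

lemma continuous_map_int_iter:
  assumes "homeomorphic_map \<tau> \<tau> T"
  shows "continuous_map \<tau> \<tau> (int_iter (topspace \<tau>) T j)"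
proof -
  obtain S where S: "homeomorphic_maps \<tau> \<tau> T S"
    using assms homeomorphic_map_maps by blast
  have inj: "inj_on T (topspace \<tau>)"
    using assms by (simp add: homeomorphic_eq_everything_map)
  have "S x = inv_into (topspace \<tau>) T x" if "x \<in> topspace \<tau>" for x
  proof -
    have "S x \<in> topspace \<tau>" "T (S x) = x"
      using S that by (auto simp: homeomorphic_maps_def continuous_map_def)
    then show ?thesis by (metis inj inv_into_f_f)
  qed
  moreover have "continuous_map \<tau> \<tau> S"
    using S by (simp add: homeomorphic_maps_def)
  ultimately have "continuous_map \<tau> \<tau> (inv_into (topspace \<tau>) T)"
    using continuous_map_eq by blast
  moreover have "continuous_map \<tau> \<tau> T"
    using S by (simp add: homeomorphic_maps_def)
  ultimately show ?thesis by (simp add: int_iter_def continuous_map_funpow)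
qed

lemma space_borel_of_topology:
  assumes "sets M = sets (borel_of_topology \<tau>)"
  shows "space M = topspace \<tau>"
  using sets_eq_imp_space_eq[OF assms] openin_subset
  by (metis borel_of_topology_def Pow_iff mem_Collect_eq space_measure_of subsetI)

lemma borel_measurable_continuous_map:
  fixes g :: "'a \<Rightarrow> 'b::topological_space"
  assumes sets: "sets M = sets (borel_of_topology \<tau>)" and g: "continuous_map \<tau> euclidean g"
  shows "g \<in> borel_measurable M"
proof (rule borel_measurableI)
  fix S :: "'b set" assume "open S"
  then have "openin \<tau> {x \<in> topspace \<tau>. g x \<in> S}"
    by (intro openin_continuous_map_preimage[OF g]) simp
  moreover have "{U. openin \<tau> U} \<subseteq> Pow (topspace \<tau>)"
    using openin_subset by blast
  ultimately have "{x \<in> topspace \<tau>. g x \<in> S} \<in> sets M"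
    unfolding sets borel_of_topology_def by (simp add: sets_measure_of)
  moreover have "g -` S \<inter> space M = {x \<in> topspace \<tau>. g x \<in> S}"
    using space_borel_of_topology[OF sets] by auto
  ultimately show "g -` S \<inter> space M \<in> sets M" by simp
qed

section \<open>Two averaging inequalities\<close>

text \<open>The mean of a constant is that constant, so the difference is itself the mean of
  \<open>c - g\<close> and inherits its pointwise bound.\<close>

lemma mean_over_close:
  assumes "finite_measure M" and C: "C \<in> sets M" "0 < measure M C"
    and g: "set_integrable M C g" and close: "\<And>x. x \<in> C \<Longrightarrow> cmod (c - g x) \<le> e"
  shows "cmod (c - mean_over M C g) \<le> e"
proof -
  interpret finite_measure M by fact
  \<comment> \<open>Used at two types: for the complex constant \<open>c\<close> and for the real
    bound \<open>e\<close>.\<close>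
  have const: "set_integrable M C (\<lambda>_. a)" for a :: "'b::{banach, second_countable_topology}"
    unfolding set_integrable_def
    using C by (intro integrable_scaleR_left integrable_real_indicator) (simp_all add: less_top[symmetric])
  have "(LINT x:C|M. c - g x) = of_real (measure M C) * c - (LINT x:C|M. g x)"
    using set_integral_diff(2)[OF const g] C by (simp add: set_integral_const scaleR_conv_of_real)
  then have "c - mean_over M C g = of_real (1 / measure M C) * (LINT x:C|M. c - g x)"
    using C by (simp add: mean_over_def field_simps)
  then have "cmod (c - mean_over M C g) = cmod (LINT x:C|M. c - g x) / measure M C"
    using C by (simp add: norm_divide)
  also have "\<dots> \<le> e"
  proof -
    have int: "set_integrable M C (\<lambda>x. c - g x)"
      using const g by (rule set_integral_diff(1))
    have "cmod (LINT x:C|M. c - g x) \<le> (LINT x:C|M. cmod (c - g x))"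
      using int by (rule set_integral_norm_bound)
    also have "\<dots> \<le> (LINT x:C|M. e)"
      using int const close by (intro set_integral_mono set_integrable_norm)
    also have "\<dots> = e * measure M C"
      using C by (simp add: set_integral_const)
    finally show ?thesis using C by (simp add: field_simps)
  qed
  finally show ?thesis .
qed

text \<open>Terms outside the exceptional set \<open>A\<close> contribute at most
  \<open>\<eta>\<close> on average; those in \<open>A\<close> contribute at most \<open>K\<close>
  times the density of \<open>A\<close> in \<open>F\<close>.\<close>

lemma average_close:
  fixes a b :: "'i \<Rightarrow> complex"
  assumes F: "finite F" "F \<noteq> {}" and "A \<subseteq> F" and "0 \<le> \<eta>"
    and good: "\<And>j. j \<in> F - A \<Longrightarrow> cmod (a j - b j) \<le> \<eta>"
    and bad: "\<And>j. j \<in> A \<Longrightarrow> cmod (a j - b j) \<le> K"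
  shows "cmod (1 / of_nat (card F) * sum a F - 1 / of_nat (card F) * sum b F)
    \<le> \<eta> + K * (real (card A) / real (card F))"
proof -
  have cF: "0 < card F" using F by (simp add: card_gt_0_iff)
  have "cmod (\<Sum>j\<in>F. a j - b j) \<le> (\<Sum>j\<in>F. cmod (a j - b j))"
    by (rule norm_sum)
  also have "\<dots> = (\<Sum>j\<in>F - A. cmod (a j - b j)) + (\<Sum>j\<in>A. cmod (a j - b j))"
    using sum.subset_diff[OF \<open>A \<subseteq> F\<close> F(1)] .
  also have "\<dots> \<le> real (card (F - A)) * \<eta> + real (card A) * K"
    using good bad by (intro add_mono sum_bounded_above) auto
  also have "\<dots> \<le> real (card F) * \<eta> + real (card A) * K"
    using F \<open>0 \<le> \<eta>\<close> by (intro add_right_mono mult_right_mono) (auto intro: card_mono)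
  finally have "cmod (\<Sum>j\<in>F. a j - b j) / real (card F) \<le> \<eta> + K * (real (card A) / real (card F))"
    using cF by (simp add: field_simps)
  moreover have "1 / of_nat (card F) * sum a F - 1 / of_nat (card F) * sum b F
      = (\<Sum>j\<in>F. a j - b j) / of_nat (card F)"
    by (simp add: sum_subtractf diff_divide_distrib)
  ultimately show ?thesis by (simp add: norm_divide)
qed

theorem theorem4p4:
  fixes X :: "'a set"
    and p :: "'a \<Rightarrow> 'a \<Rightarrow> real"
    and T :: "'a \<Rightarrow> 'a"
    and M :: "'a measure"
    and H L :: "int \<Rightarrow> real"
    and x\<^sub>0 :: 'a
    and F :: "nat \<Rightarrow> int set"
    and \<Xi> :: "('a \<Rightarrow> complex) set"
    and \<Delta> :: "int \<Rightarrow> real \<Rightarrow> real"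
    and C :: "nat \<Rightarrow> 'a set"
    and f :: "'a \<Rightarrow> complex"
    and lam :: real
  assumes pseudometric: "pseudometric_on X p"
    and compact: "compact_space (pm_topology X p)"
    and homeo: "homeomorphic_map (pm_topology X p) (pm_topology X p) T"
    and prob: "prob_space M"
    and regular: "regular_borel_measure (pm_topology X p) M"
    and H_pos: "\<And>j. 0 < H j"
    and L_pos: "\<And>j. 0 < L j"
    and holder: "\<And>j x y. x \<in> X \<Longrightarrow> y \<in> X \<Longrightarrow>
      p (int_iter X T j x) (int_iter X T j y) \<le> L j * p x y powr H j"
    and x0: "x\<^sub>0 \<in> X"
    and F: "\<And>k. 1 \<le> k \<Longrightarrow> finite (F k) \<and> F k \<noteq> {}"
    and \<Xi>_cont: "\<And>\<xi>. \<xi> \<in> \<Xi> \<Longrightarrow> continuous_map (pm_topology X p) (top_of_set (sphere 0 1)) \<xi>"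
    and \<Xi>_equicont: "uniformly_equicontinuous X p \<Xi>"
    and modulus: "\<And>j. modulus_of_equicontinuity X p ((\<lambda>\<xi>. fun_powi \<xi> j) ` \<Xi>) (\<Delta> j)"
    and C_meas: "\<And>k. 1 \<le> k \<Longrightarrow> C k \<in> sets M"
    and C_pos: "\<And>k. 1 \<le> k \<Longrightarrow> 0 < measure M (C k)"
    and C_x0: "\<And>k. 1 \<le> k \<Longrightarrow> x\<^sub>0 \<in> C k"
    and lim_HL: "\<And>\<delta>. 0 < \<delta> \<Longrightarrow>
      (\<lambda>k. real (card {j \<in> F k. L j * pm_diam p (C k) powr H j > \<delta>}) / real (card (F k)))
        \<longlonglongrightarrow> 0"
    and lim_\<Delta>: "\<And>\<epsilon>. \<epsilon> \<in> {0<..<1} \<Longrightarrow>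
      (\<lambda>k. real (card {j \<in> F k. pm_diam p (C k) > \<Delta> j \<epsilon>}) / real (card (F k)))
        \<longlonglongrightarrow> 0"
    and f_cont: "continuous_map (pm_topology X p) euclidean f"
    and f_bdd: "bounded (f ` X)"
    and lam_pos: "0 < lam"
    and lam: "\<And>j k. 1 \<le> j \<Longrightarrow> 1 \<le> k \<Longrightarrow>
      measure M (int_iter X T j ` C k) \<le> lam * measure M (C k)"
  shows "(\<forall>\<xi>\<in>\<Xi>. (\<lambda>k. cmod (weighted_avg X T (F k) \<xi> f x\<^sub>0
                           - mean_over M (C k) (weighted_avg X T (F k) \<xi> f))) \<longlonglongrightarrow> 0) \<and>
         uniform_limit \<Xi>
           (\<lambda>k \<xi>. cmod (weighted_avg X T (F k) \<xi> f x\<^sub>0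
                           - mean_over M (C k) (weighted_avg X T (F k) \<xi> f)))
           (\<lambda>_. 0) sequentially"
proof -
  let ?\<tau> = "pm_topology X p"
  let ?g = "\<lambda>k \<xi>. weighted_avg X T (F k) \<xi> f"
  interpret prob_space M by (rule prob)
  have sets: "sets M = sets (borel_of_topology ?\<tau>)"
    using regular by (simp add: regular_borel_measure_def)
  have space: "space M = X"
    using space_borel_of_topology[OF sets] by simp
  have CX: "C k \<subseteq> X" if "1 \<le> k" for k
    using sets.sets_into_space[OF C_meas[OF that]] space by simp
  \<comment> \<open>The bound is taken strictly positive because the tolerances below divide by
    it.\<close>
  obtain B where "0 < B" and B: "\<And>x. x \<in> X \<Longrightarrow> cmod (f x) \<le> B"
    using f_bdd unfolding bounded_pos by auto
  have T_cont: "continuous_map ?\<tau> ?\<tau> (int_iter X T j)" for j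
    using continuous_map_int_iter[OF homeo] by simp
  then have T_in: "int_iter X T j x \<in> X" if "x \<in> X" for j x
    using that by (force simp: continuous_map_def)
  have norm_\<xi>: "cmod (fun_powi \<xi> j x) = 1" if "\<xi> \<in> \<Xi>" "x \<in> X" for \<xi> j x
  proof -
    have "\<xi> x \<in> sphere 0 1"
      using \<Xi>_cont[OF \<open>\<xi> \<in> \<Xi>\<close>] \<open>x \<in> X\<close> by (force simp: continuous_map_def)
    then show ?thesis by (simp add: fun_powi_def norm_power_int)
  qed
  have norm_term: "cmod (fun_powi \<xi> j x * f (int_iter X T j x)) \<le> B" if "\<xi> \<in> \<Xi>" "x \<in> X" for \<xi> j x
    using norm_\<xi>[OF that] B[OF T_in[OF that(2)]] by (simp add: norm_mult)
  have meas_term: "(\<lambda>x. fun_powi \<xi> j x * f (int_iter X T j x)) \<in> borel_measurable M" if "\<xi> \<in> \<Xi>" for \<xi> j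
  proof -
    have [measurable]: "\<xi> \<in> borel_measurable M"
      using borel_measurable_continuous_map[OF sets] \<Xi>_cont[OF that] continuous_map_in_subtopology
      by blast
    have [measurable]: "(\<lambda>x. f (int_iter X T j x)) \<in> borel_measurable M"
      using borel_measurable_continuous_map[OF sets continuous_map_compose[OF T_cont f_cont]]
      by (simp add: comp_def)
    \<comment> \<open>\<open>powi\<close> is an ordinary power for nonnegative exponents and a power
      of the inverse otherwise; both are measurable.\<close>
    show ?thesis
      by (cases "0 \<le> j") (simp_all add: fun_powi_def power_int_def)
  qed
  have int_avg: "set_integrable M (C k) (?g k \<xi>)" if "1 \<le> k" "\<xi> \<in> \<Xi>" for k \<xi>
  proof -
    have "integrable M (\<lambda>x. fun_powi \<xi> j x * f (int_iter X T j x))" for j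
      using meas_term norm_term that space by (intro integrable_const_bound[where B = B]) auto
    then have "integrable M (?g k \<xi>)"
      unfolding weighted_avg_def by auto
    then show ?thesis
      using C_meas[OF that(1)] unfolding set_integrable_def
      by (intro integrable_mult_indicator)
  qed
  \<comment> \<open>Only uniform convergence needs proof; the pointwise limits follow from
    it.\<close>
  have "uniform_limit \<Xi> (\<lambda>k \<xi>. cmod (?g k \<xi> x\<^sub>0 - mean_over M (C k) (?g k \<xi>))) (\<lambda>_. 0) sequentially"
  proof (rule uniform_limitI)
    fix e :: real assume "0 < e"
    obtain d where "0 < d"
      and d: "\<And>x y. x \<in> X \<Longrightarrow> y \<in> X \<Longrightarrow> p x y < d \<Longrightarrow> dist (f x) (f y) < e / 4"
      using continuous_pm_uniformly_continuous[OF pseudometric compact f_cont, of "e / 4"] \<open>0 < e\<close>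
      by auto
    \<comment> \<open>The factor 1/2 keeps \<epsilon> in the domain of the moduli; the other makes
      the variation of \<xi>^j, multiplied by the bound on \<open>f\<close>, cost at most
      \<open>e / 4\<close>.\<close>
    define \<epsilon> where "\<epsilon> = min (1 / 2) (e / (4 * B))"
    have \<epsilon>: "\<epsilon> \<in> {0<..<1}" "\<epsilon> * B \<le> e / 4"
      using \<open>0 < e\<close> \<open>0 < B\<close> by (auto simp: \<epsilon>_def min_def field_simps)
    \<comment> \<open>Outside this set the bound is only \<open>\<le> d / 2\<close>; halving turns
      it into the strict \<open>< d\<close> that uniform continuity asks for.\<close>
    define A\<^sub>1 where "A\<^sub>1 k = {j \<in> F k. L j * pm_diam p (C k) powr H j > d / 2}" for k
    define A\<^sub>2 where "A\<^sub>2 k = {j \<in> F k. pm_diam p (C k) > \<Delta> j \<epsilon>}" for k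
    \<comment> \<open>Two exceptional sets of this density, with terms differing by at most
      \<open>2 * B\<close>, cost \<open>e / 4\<close> altogether. Neither set depends on \<xi>,
      whence the uniformity.\<close>
    have small: "0 < e / (16 * B)" using \<open>0 < e\<close> \<open>0 < B\<close> by simp
    have "\<forall>\<^sub>F k in sequentially. real (card (A\<^sub>1 k)) / real (card (F k)) < e / (16 * B)"
      using order_tendstoD(2)[OF lim_HL[of "d / 2"] small] \<open>0 < d\<close> by (simp add: A\<^sub>1_def)
    moreover have "\<forall>\<^sub>F k in sequentially. real (card (A\<^sub>2 k)) / real (card (F k)) < e / (16 * B)"
      using order_tendstoD(2)[OF lim_\<Delta>[OF \<epsilon>(1)] small] by (simp add: A\<^sub>2_def)
    ultimately show "\<forall>\<^sub>F k in sequentially. \<forall>\<xi>\<in>\<Xi>.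
        dist (cmod (?g k \<xi> x\<^sub>0 - mean_over M (C k) (?g k \<xi>))) 0 < e"
      using eventually_ge_at_top[of 1]
    proof eventually_elim
      case (elim k)
      note k = \<open>1 \<le> k\<close>
      define A where "A = A\<^sub>1 k \<union> A\<^sub>2 k"
      have "real (card A) \<le> real (card (A\<^sub>1 k)) + real (card (A\<^sub>2 k))"
        unfolding A_def using card_Un_le[of "A\<^sub>1 k" "A\<^sub>2 k"] by linarith
      then have "real (card A) / real (card (F k))
          \<le> real (card (A\<^sub>1 k)) / real (card (F k)) + real (card (A\<^sub>2 k)) / real (card (F k))"
        by (simp add: add_divide_distrib[symmetric] divide_right_mono)
      then have "real (card A) / real (card (F k)) \<le> e / (8 * B)"
        using elim by simp
      then have A_small: "2 * B * (real (card A) / real (card (F k))) \<le> e / 4"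
        using \<open>0 < B\<close> by (simp add: field_simps)
      show ?case
      proof
        fix \<xi> assume \<xi>: "\<xi> \<in> \<Xi>"
        \<comment> \<open>The ordinary indices cost \<open>e / 2\<close> and the exceptional ones
          \<open>e / 4\<close>. The slack below \<open>e\<close> restores strictness after taking
          the mean.\<close>
        have "cmod (?g k \<xi> x\<^sub>0 - ?g k \<xi> x) \<le> 3 * e / 4" if x: "x \<in> C k" for x
        proof -
          have "x \<in> X" using x CX k by blast
          have diam: "p x\<^sub>0 x \<le> pm_diam p (C k)"
            using pm_le_pm_diam[OF pseudometric compact CX C_x0 x] k by blast
          let ?t = "\<lambda>j x. fun_powi \<xi> j x * f (int_iter X T j x)"
          have "cmod (?g k \<xi> x\<^sub>0 - ?g k \<xi> x) \<le> e / 2 + 2 * B * (real (card A) / real (card (F k)))"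
            unfolding weighted_avg_def
          proof (rule average_close)
            show "finite (F k)" "F k \<noteq> {}" using F k by auto
            show "A \<subseteq> F k" by (auto simp: A_def A\<^sub>1_def A\<^sub>2_def)
            show "0 \<le> e / 2" using \<open>0 < e\<close> by simp
            show "cmod (?t j x\<^sub>0 - ?t j x) \<le> 2 * B" for j
              using norm_triangle_ineq4[of "?t j x\<^sub>0" "?t j x"]
                norm_term[OF \<xi> x0, of j] norm_term[OF \<xi> \<open>x \<in> X\<close>, of j] by linarith
            fix j assume j: "j \<in> F k - A"
            let ?u = "int_iter X T j x\<^sub>0" and ?v = "int_iter X T j x"
            \<comment> \<open>Positivity of \<open>H j\<close> makes the power monotone in its base,
              so the Hoelder bound can be stated through the diameter.\<close>
            have "p x\<^sub>0 x powr H j \<le> pm_diam p (C k) powr H j"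
              using diam pseudometric x0 \<open>x \<in> X\<close> H_pos[of j]
              by (intro powr_mono2) (auto simp: pseudometric_on_def)
            then have "p ?u ?v \<le> L j * pm_diam p (C k) powr H j"
              using holder[OF x0 \<open>x \<in> X\<close>, of j] L_pos[of j]
              by (meson less_imp_le mult_left_mono order_trans)
            also have "\<dots> < d" using j \<open>0 < d\<close> by (auto simp: A_def A\<^sub>1_def)
            finally have f_close: "cmod (f ?u - f ?v) \<le> e / 4"
              using d[OF T_in T_in] x0 \<open>x \<in> X\<close> by (fastforce simp: dist_norm)
            have "p x\<^sub>0 x \<le> \<Delta> j \<epsilon>" using diam j by (auto simp: A_def A\<^sub>2_def)
            then have \<xi>_close: "cmod (fun_powi \<xi> j x\<^sub>0 - fun_powi \<xi> j x) \<le> \<epsilon>"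
              using modulus[of j] \<xi> \<epsilon>(1) x0 \<open>x \<in> X\<close> unfolding modulus_of_equicontinuity_def by blast
            \<comment> \<open>The mixed term \<open>fun_powi \<xi> j x * f ?u\<close> is subtracted
              and added, separating the variation of \<xi>^j, weighted by at most \<open>B\<close>,
              from that of \<open>f\<close>, weighted by a number of modulus 1.\<close>
            have "?t j x\<^sub>0 - ?t j x = (fun_powi \<xi> j x\<^sub>0 - fun_powi \<xi> j x) * f ?u
                + fun_powi \<xi> j x * (f ?u - f ?v)"
              by (simp add: algebra_simps)
            then have "cmod (?t j x\<^sub>0 - ?t j x)
                \<le> cmod (fun_powi \<xi> j x\<^sub>0 - fun_powi \<xi> j x) * cmod (f ?u) + cmod (f ?u - f ?v)"
              using norm_triangle_ineq[of "(fun_powi \<xi> j x\<^sub>0 - fun_powi \<xi> j x) * f ?u"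
                  "fun_powi \<xi> j x * (f ?u - f ?v)"] norm_\<xi>[OF \<xi> \<open>x \<in> X\<close>, of j]
              by (simp add: norm_mult)
            also have "\<dots> \<le> \<epsilon> * B + e / 4"
              using \<xi>_close f_close B[OF T_in[OF x0]] \<epsilon>(1) by (intro add_mono mult_mono) auto
            finally show "cmod (?t j x\<^sub>0 - ?t j x) \<le> e / 2"
              using \<epsilon>(2) by simp
          qed
          with A_small show ?thesis by simp
        qed
        from mean_over_close[OF finite_measure_axioms C_meas[OF k] C_pos[OF k] int_avg[OF k \<xi>] this]
        show "dist (cmod (?g k \<xi> x\<^sub>0 - mean_over M (C k) (?g k \<xi>))) 0 < e"
          using \<open>0 < e\<close> by simp
      qed
    qed
  qed
  then show ?thesis by (auto dest: tendsto_uniform_limitI)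
qed

end
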